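(* Let $s\ge 1$ be an integer and let $a_1,\dots,a_s,b_1,\dots,b_s,c_1,\dots,c_s\in\mathbb{R}$. For square matrices $A,B$ of the same size and $\tau\in\mathbb{R}$ put $$\mathcal{S}^{(1)}_{A,B}(\tau)=e^{c_s\tau^3[B,[B,A]]}e^{b_s\tau B}e^{a_s\tau A}\cdots e^{c_1\tau^3[B,[B,A]]}e^{b_1\tau B}e^{a_1\tau A},$$ $$\mathcal{S}^{(2)}_{A,B}(\tau)=e^{b_s\tau B+c_s\tau^3[B,[B,A]]}e^{a_s\tau A}\cdots e^{b_1\tau B+c_1\tau^3[B,[B,A]]}e^{a_1\tau A}.$$ (i) Suppose that, for $k=1$ or for $k=2$, the method $\mathcal{S}^{(k)}$ is of order $p$ for some integer $p\ge 5$, i.e. for every $d\ge 1$ and all real or complex $d\times d$ matrices $A,B$ one has $\mathcal{S}^{(k)}_{A,B}(\tau)=e^{\tau(A+B)}+O(\tau^{p+1})$ as $\tau\to 0$. Then at least one of the coefficients $a_1,\dots,a_s$ is strictly negative. (ii) Suppose that the method $\mathcal{S}^{(2)}$ is of order $p$ for some integer $p\ge 5$ when applied to problems with $[B,[B,[B,A]]]=0$, i.e. for every $d\ge 1$ and all real or complex $d\times d$ matrices $A,B$ satisfying $[B,[B,[B,A]]]=0$ one has $\mathcal{S}^{(2)}_{A,B}(\tau)=e^{\tau(A+B)}+O(\tau^{p+1})$ as $\tau\to 0$. Then at least one of the coefficients $a_1,\dots,a_s$ is strictly negative.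
   Context: $[X,Y]=XY-YX$ denotes the matrix commutator and $e^X$ the matrix exponential. The products are ordered so that the index decreases from $s$ (leftmost) to $1$ (rightmost). The methods are one-step integrators $y_{n+1}=\mathcal{S}(\tau)y_n$ for linear evolution equations $\partial_t y=Ay+By$ on $\mathbb{R}^d$ or $\mathbb{C}^d$. The coefficients $a_j,b_j,c_j$ are fixed and do not depend on $d$, $A$, $B$ or $\tau$. Being of order $p$ means that the error estimate $O(\tau^{p+1})$ holds for all problems in the indicated class, where the constant in $O(\cdot)$ may depend on $A$ and $B$. *)

theory Defs
  imports Complex_Main "HOL-Library.Landau_Symbols" "Jordan_Normal_Form.Matrix"
begin

definition mat_comm :: "'a::ring_1 mat \<Rightarrow> 'a mat \<Rightarrow> 'a mat" where
  "mat_comm X Y = X * Y - Y * X"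

text \<open>The exponential series of a square matrix, summed entry by entry. Since the space of
  matrices is finite-dimensional, this is its sum in any norm; the series always converges
  (see \<open>summable_mat_exp\<close> below).\<close>

definition mat_exp :: "'a::{real_normed_field,banach} mat \<Rightarrow> 'a mat" where
  "mat_exp X = mat (dim_row X) (dim_row X) (\<lambda>(i, j). \<Sum>k. (X ^\<^sub>m k) $$ (i, j) / fact k)"

lemma summable_mat_exp:
  fixes X :: "'a::{real_normed_field,banach} mat"
  assumes X: "X \<in> carrier_mat d d" and ij: "i < d" "j < d"
  shows "summable (\<lambda>k. (X ^\<^sub>m k) $$ (i, j) / fact k)"
proof -
  define M where "M = (\<Sum>p\<in>{..<d} \<times> {..<d}. norm (X $$ p))"
  have M: "norm (X $$ (l, m)) \<le> M" if "l < d" "m < d" for l m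
    unfolding M_def by (rule member_le_sum) (use that in auto)
  have M0: "M \<ge> 0" unfolding M_def by (rule sum_nonneg) auto
  have bound: "norm ((X ^\<^sub>m k) $$ (l, m)) \<le> (real d * M) ^ k" if "l < d" "m < d" for k l m
    using that
  proof (induction k arbitrary: l m)
    case 0
    then show ?case using X by auto
  next
    case (Suc k)
    have Xk: "X ^\<^sub>m k \<in> carrier_mat d d" using X by simp
    have "(X ^\<^sub>m Suc k) $$ (l, m) = (\<Sum>q<d. (X ^\<^sub>m k) $$ (l, q) * X $$ (q, m))"
      using Xk X Suc.prems by (simp add: scalar_prod_def atLeast0LessThan)
    also have "norm \<dots> \<le> (\<Sum>q<d. (real d * M) ^ k * M)"
      by (rule sum_norm_le) (use Suc M M0 in \<open>auto simp: norm_mult intro!: mult_mono\<close>)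
    also have "\<dots> = (real d * M) ^ Suc k" by simp
    finally show ?case .
  qed
  have "summable (\<lambda>k. inverse (fact k) * (real d * M) ^ k)"
    by (rule summable_exp)
  then show ?thesis
    by (rule summable_comparison_test') (use bound ij in \<open>auto simp: norm_divide divide_simps\<close>)
qed

text \<open>The two schemes. The recursion multiplies each new stage from the left, so that stage \<open>s\<close>
  stands leftmost and stage \<open>1\<close> rightmost.\<close>

primrec splitting1 ::
  "(nat \<Rightarrow> real) \<Rightarrow> (nat \<Rightarrow> real) \<Rightarrow> (nat \<Rightarrow> real) \<Rightarrow> nat \<Rightarrow>
   'a::{real_normed_field,banach} mat \<Rightarrow> 'a mat \<Rightarrow> real \<Rightarrow> 'a mat" where
  "splitting1 a b c 0 A B \<tau> = 1\<^sub>m (dim_row A)"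
| "splitting1 a b c (Suc n) A B \<tau> =
     mat_exp (of_real (c (Suc n) * \<tau> ^ 3) \<cdot>\<^sub>m mat_comm B (mat_comm B A)) *
     mat_exp (of_real (b (Suc n) * \<tau>) \<cdot>\<^sub>m B) *
     mat_exp (of_real (a (Suc n) * \<tau>) \<cdot>\<^sub>m A) *
     splitting1 a b c n A B \<tau>"

primrec splitting2 ::
  "(nat \<Rightarrow> real) \<Rightarrow> (nat \<Rightarrow> real) \<Rightarrow> (nat \<Rightarrow> real) \<Rightarrow> nat \<Rightarrow>
   'a::{real_normed_field,banach} mat \<Rightarrow> 'a mat \<Rightarrow> real \<Rightarrow> 'a mat" where
  "splitting2 a b c 0 A B \<tau> = 1\<^sub>m (dim_row A)"
| "splitting2 a b c (Suc n) A B \<tau> =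
     mat_exp (of_real (b (Suc n) * \<tau>) \<cdot>\<^sub>m B
              + of_real (c (Suc n) * \<tau> ^ 3) \<cdot>\<^sub>m mat_comm B (mat_comm B A)) *
     mat_exp (of_real (a (Suc n) * \<tau>) \<cdot>\<^sub>m A) *
     splitting2 a b c n A B \<tau>"

text \<open>The \<open>O\<close>-estimate is imposed on every entry, which is the same as imposing it in any matrix
  norm. The implied constant may depend on \<open>A\<close>, \<open>B\<close> (and \<open>d\<close>). The predicate \<open>P\<close> describes the
  class of problems.\<close>

definition order_on ::
  "('a::{real_normed_field,banach} mat \<Rightarrow> 'a mat \<Rightarrow> bool) \<Rightarrow>
   ('a mat \<Rightarrow> 'a mat \<Rightarrow> real \<Rightarrow> 'a mat) \<Rightarrow> nat \<Rightarrow> bool" where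
  "order_on P S p \<longleftrightarrow>
     (\<forall>d\<ge>1. \<forall>A\<in>carrier_mat d d. \<forall>B\<in>carrier_mat d d. P A B \<longrightarrow>
        (\<forall>i<d. \<forall>j<d.
           (\<lambda>\<tau>. norm ((S A B \<tau> - mat_exp (of_real \<tau> \<cdot>\<^sub>m (A + B))) $$ (i, j)))
             \<in> O[at 0](\<lambda>\<tau>. \<tau> ^ (p + 1))))"

definition any_problem :: "'a mat \<Rightarrow> 'a mat \<Rightarrow> bool" where
  "any_problem A B \<longleftrightarrow> True"

definition triple_comm_zero :: "'a::ring_1 mat \<Rightarrow> 'a mat \<Rightarrow> bool" where
  "triple_comm_zero A B \<longleftrightarrow>
     mat_comm B (mat_comm B (mat_comm B A)) = 0\<^sub>m (dim_row A) (dim_row A)"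

end

theory Submission
  imports "HOL-Analysis.Equivalence_Lebesgue_Henstock_Integration" Defs
begin

text \<open>Suppose that a scheme of order at least \<open>5\<close> had only nonnegative \<open>a\<^sub>j\<close>, and put
  \<open>x\<^sub>k = a\<^sub>1 + ... + a\<^sub>k\<close>. Comparing the coefficients of the words \<open>A\<close>, \<open>BA\<^sup>m\<close> and
  \<open>BAAAB\<close> in the scheme and in \<open>exp (\<tau> (A + B))\<close> gives \<open>x\<^sub>s = 1\<close>,
  \<open>\<Sum>k. b\<^sub>k x\<^sub>k ^ m = 1 / (m + 1)\<close> for \<open>m \<le> 4\<close>, and
  \<open>\<Sum>j<k. b\<^sub>j b\<^sub>k (x\<^sub>k - x\<^sub>j) ^ 3 = 1 / 20\<close>. The coefficients \<open>c\<^sub>j\<close> do not appear, because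
  the double commutator consists of the words \<open>BBA\<close>, \<open>BAB\<close>, \<open>ABB\<close>, none of which is
  contained in these words. All comparisons take place in one pair of real \<open>7 \<times> 7\<close> matrices, the
  prefix tree of \<open>BAAAA\<close> and \<open>BAAAB\<close>, on which \<open>[B, [B, A]] = 0\<close>
  (lemma \<open>mat_comm_probe\<close>). Hence both schemes reduce to the same ordinary splitting there, the
  restriction \<open>[B, [B, [B, A]]] = 0\<close> of the second part holds as well, and one argument settles
  all three claims (lemma \<open>order_conditions\<close>).

  The conditions are contradictory. Since the \<open>a\<^sub>j\<close> are nonnegative, the nodes \<open>x\<^sub>k\<close>
  form a nondecreasing sequence in \<open>{0..1}\<close>, and the last condition says that the double sum of
  \<open>b\<^sub>j b\<^sub>k \<bar>x\<^sub>j - x\<^sub>k\<bar> ^ 3\<close> equals \<open>1 / 10\<close>, the value that the uniform measure on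
  \<open>{0..1}\<close> has. But \<open>\<bar>x - y\<bar> ^ 3\<close> is a conditionally positive definite kernel: its double
  integral against a signed measure with vanishing moments of order \<open>0\<close> and \<open>1\<close> is twelve
  times the square integral of the second antiderivative. For the difference of the quadrature rule
  and the uniform measure this energy is zero, by exactness up to degree \<open>4\<close>; so the rule would
  be equal to the uniform measure, which is impossible for finitely many nodes
  (lemma \<open>exact_quadrature_cubic_energy_ne\<close>).\<close>

section \<open>The cubic energy of an exact quadrature rule\<close>

lemma has_integral_vanishing_left:
  fixes f G :: "real \<Rightarrow> real"
  assumes y: "0 \<le> y" "y \<le> 1"
    and G: "\<And>t. (G has_real_derivative f t) (at t)"
    and g: "\<And>t. t \<in> {0..1} \<Longrightarrow> g t = (if y \<le> t then f t else 0)"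
  shows "(g has_integral G 1 - G y) {0..1}"
proof -
  have "(f has_integral G 1 - G y) {y..1}"
    using y G by (intro fundamental_theorem_of_calculus)
      (auto simp: has_real_derivative_iff_has_vector_derivative[symmetric]
            intro: has_field_derivative_at_within)
  then have "((\<lambda>t. if t \<in> {y..1} then f t else 0) has_integral G 1 - G y) {0..1}"
    using y by (subst has_integral_restrict) auto
  then show ?thesis
    by (rule has_integral_eq[rotated]) (use g in auto)
qed

text \<open>The product of two ramps is the cubic spline kernel: up to a symmetric polynomial, which an exact
  quadrature rule integrates as the uniform measure does, it is \<open>\<bar>x - y\<bar> ^ 3 / 12\<close>. The
  polynomial part is written in powers of \<open>1 - x\<close> and \<open>1 - y\<close> because the ramps see only
  the part of the interval to the right of the nodes.\<close>

lemma has_integral_ramp_ramp_ordered: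
  fixes x y :: real
  assumes "0 \<le> x" "x \<le> y" "y \<le> 1"
  shows "((\<lambda>t. max 0 (t - x) * max 0 (t - y)) has_integral
    \<bar>x - y\<bar> ^ 3 / 12 + ((1 - x) * (1 - y)\<^sup>2 + (1 - x)\<^sup>2 * (1 - y)) / 4
      - ((1 - x) ^ 3 + (1 - y) ^ 3) / 12) {0..1}"
proof -
  let ?f = "\<lambda>t. (t - x) * (t - y)"
  let ?G = "\<lambda>t::real. (t - y) ^ 3 / 3 + (y - x) * (t - y)\<^sup>2 / 2"
  have "((\<lambda>t. max 0 (t - x) * max 0 (t - y)) has_integral ?G 1 - ?G y) {0..1}"
  proof (rule has_integral_vanishing_left)
    show "(?G has_real_derivative ?f t) (at t)" for t
      by (auto intro!: derivative_eq_intros simp: field_simps power2_eq_square)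
  qed (use assms in auto)
  also have "?G 1 - ?G y = (y - x) ^ 3 / 12 + ((1 - x) * (1 - y)\<^sup>2 + (1 - x)\<^sup>2 * (1 - y)) / 4
      - ((1 - x) ^ 3 + (1 - y) ^ 3) / 12"
    by (simp add: field_simps power2_eq_square power3_eq_cube)
  also have "y - x = \<bar>x - y\<bar>" using assms by simp
  finally show ?thesis .
qed

lemma has_integral_ramp_ramp:
  fixes x y :: real
  assumes "x \<in> {0..1}" "y \<in> {0..1}"
  shows "((\<lambda>t. max 0 (t - x) * max 0 (t - y)) has_integral
    \<bar>x - y\<bar> ^ 3 / 12 + ((1 - x) * (1 - y)\<^sup>2 + (1 - x)\<^sup>2 * (1 - y)) / 4
      - ((1 - x) ^ 3 + (1 - y) ^ 3) / 12) {0..1}"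
proof (cases "x \<le> y")
  case True
  then show ?thesis using has_integral_ramp_ramp_ordered assms by simp
next
  case False
  then show ?thesis using has_integral_ramp_ramp_ordered[of y x] assms
    by (simp add: mult.commute add.commute abs_minus_commute)
qed

lemma has_integral_ramp_square:
  fixes x :: real
  assumes "x \<in> {0..1}"
  shows "((\<lambda>t. max 0 (t - x) * t\<^sup>2) has_integral 1 / 4 - x / 3 + x ^ 4 / 12) {0..1}"
proof -
  let ?f = "\<lambda>t. (t - x) * t\<^sup>2" and ?G = "\<lambda>t::real. t ^ 4 / 4 - x * t ^ 3 / 3"
  have "((\<lambda>t. max 0 (t - x) * t\<^sup>2) has_integral ?G 1 - ?G x) {0..1}"
  proof (rule has_integral_vanishing_left)
    show "(?G has_real_derivative ?f t) (at t)" for t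
      by (auto intro!: derivative_eq_intros simp: field_simps power2_eq_square power3_eq_cube)
  qed (use assms in auto)
  then show ?thesis
    by (simp add: field_simps power2_eq_square power3_eq_cube power4_eq_xxxx)
qed

lemma sum_symmetric_off_diagonal:
  fixes f :: "nat \<Rightarrow> nat \<Rightarrow> real"
  assumes sym: "\<And>j k. f j k = f k j" and diag: "\<And>k. f k k = 0"
  shows "(\<Sum>j=1..n. \<Sum>k=1..n. f j k) = 2 * (\<Sum>k=1..n. \<Sum>j=1..<k. f j k)"
proof (induction n)
  case (Suc n)
  have "(\<Sum>j=1..Suc n. \<Sum>k=1..Suc n. f j k)
      = (\<Sum>j=1..n. \<Sum>k=1..n. f j k) + 2 * (\<Sum>j=1..n. f j (Suc n))"
    using sym[of _ "Suc n"] by (simp add: sum.distrib diag)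
  then show ?case
    using Suc.IH by (simp add: atLeastLessThanSuc_atLeastAtMost)
qed simp

text \<open>To the right of \<open>0\<close> there is a gap before the next node, and on it a combination of ramps is
  linear while the parabola is not. This is the place where the discreteness of the quadrature
  enters.\<close>

lemma ramp_combination_ne_parabola:
  fixes b x :: "nat \<Rightarrow> real"
  assumes x: "\<And>k. k \<in> {1..s} \<Longrightarrow> 0 \<le> x k"
  shows "\<exists>t\<in>{0..1}. (\<Sum>k=1..s. b k * max 0 (t - x k)) \<noteq> t\<^sup>2 / 2"
proof (rule ccontr)
  assume "\<not> ?thesis"
  then have eq: "(\<Sum>k=1..s. b k * max 0 (t - x k)) = t\<^sup>2 / 2" if "t \<in> {0..1}" for t
    using that by blast
  (* r is the least positive node; the point 1 keeps r in the unit interval *)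
  define R where "R = insert 1 {x k |k. k \<in> {1..s} \<and> 0 < x k}"
  define r where "r = Min R"
  have fin: "finite R" by (simp add: R_def)
  have r: "0 < r" "r \<le> 1"
    using Min_in[OF fin] Min_le[OF fin, of 1] by (auto simp: r_def R_def)
  have gap: "x k = 0 \<or> r \<le> x k" if "k \<in> {1..s}" for k
  proof (cases "x k = 0")
    case False
    then have "x k \<in> R" using x[OF that] that by (auto simp: R_def)
    then show ?thesis using Min_le[OF fin] by (simp add: r_def)
  qed simp
  define \<beta> where "\<beta> = (\<Sum>k=1..s. if x k = 0 then b k else 0)"
  have lin: "\<beta> * t = t\<^sup>2 / 2" if t: "0 \<le> t" "t \<le> r" for t
  proof -
    have "\<beta> * t = (\<Sum>k=1..s. b k * max 0 (t - x k))"
      unfolding \<beta>_def sum_distrib_right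
      by (rule sum.cong) (use gap t in force)+
    then show ?thesis using eq[of t] t r by simp
  qed
  have "\<beta> * r = r\<^sup>2 / 2" "\<beta> * (r / 2) = (r / 2)\<^sup>2 / 2"
    using lin[of r] lin[of "r / 2"] r by auto
  then show False using r by (simp add: power2_eq_square)
qed

text \<open>Let \<open>\<mu>\<close> be the signed measure \<open>\<Sum>k. b k \<delta>(x k)\<close> minus the uniform measure on
  \<open>{0..1}\<close>. Its second antiderivative vanishing to the left of \<open>0\<close> is the function \<open>F\<close>
  of the proof, and by the kernel lemma the integral of \<open>F\<^sup>2\<close> is a polynomial expression in the
  moments plus a twelfth of the double integral of \<open>\<bar>x - y\<bar> ^ 3\<close> against \<open>\<mu>\<close>. Exactness
  up to degree \<open>4\<close> makes the polynomial and the mixed terms equal to those of the uniform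
  measure; degree \<open>4\<close> is what the mixed terms require, since \<open>\<bar>x - y\<bar> ^ 3\<close> integrates in
  \<open>y\<close> to \<open>(x ^ 4 + (1 - x) ^ 4) / 4\<close>. The uniform measure has cubic energy \<open>1 / 10\<close>,
  so a rule with the same energy would give \<open>F = 0\<close>.\<close>

lemma exact_quadrature_cubic_energy_ne:
  fixes b x :: "nat \<Rightarrow> real"
  assumes x: "\<And>k. k \<in> {1..s} \<Longrightarrow> x k \<in> {0..1}"
    and moments: "\<And>m. m \<le> 4 \<Longrightarrow> (\<Sum>k=1..s. b k * x k ^ m) = 1 / (real m + 1)"
  shows "(\<Sum>j=1..s. \<Sum>k=1..s. b j * b k * \<bar>x j - x k\<bar> ^ 3) \<noteq> 1 / 10"
proof
  assume cubic: "(\<Sum>j=1..s. \<Sum>k=1..s. b j * b k * \<bar>x j - x k\<bar> ^ 3) = 1 / 10"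
  define F where "F = (\<lambda>t. (\<Sum>k=1..s. b k * max 0 (t - x k)) - t\<^sup>2 / 2)"
  (* the part of the kernel besides the cubic, and the moments u of 1 - x in which it is expressed *)
  define p where "p = (\<lambda>x y::real. ((1 - x) * (1 - y)\<^sup>2 + (1 - x)\<^sup>2 * (1 - y)) / 4
      - ((1 - x) ^ 3 + (1 - y) ^ 3) / 12)"
  define u where "u = (\<lambda>m. \<Sum>k=1..s. b k * (1 - x k) ^ m)"

  have m: "(\<Sum>k=1..s. b k) = 1" "(\<Sum>k=1..s. b k * x k) = 1 / 2"
    "(\<Sum>k=1..s. b k * x k ^ 2) = 1 / 3" "(\<Sum>k=1..s. b k * x k ^ 3) = 1 / 4"
    "(\<Sum>k=1..s. b k * x k ^ 4) = 1 / 5"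
    using moments[of 0] moments[of 1] moments[of 2] moments[of 3] moments[of 4] by simp_all
  have "u 2 = (\<Sum>k=1..s. b k - 2 * (b k * x k) + b k * x k ^ 2)"
    unfolding u_def by (rule sum.cong) (auto simp: algebra_simps power2_eq_square)
  moreover have "u 3 = (\<Sum>k=1..s. b k - 3 * (b k * x k) + 3 * (b k * x k ^ 2) - b k * x k ^ 3)"
    unfolding u_def by (rule sum.cong) (auto simp: algebra_simps power2_eq_square power3_eq_cube)
  ultimately have u: "u 0 = 1" "u 1 = 1 / 2" "u 2 = 1 / 3" "u 3 = 1 / 4"
    using m by (simp_all add: u_def sum.distrib sum_subtractf right_diff_distrib
        sum_distrib_left[symmetric])

  have uu: "(\<Sum>j=1..s. \<Sum>k=1..s. b j * b k * ((1 - x j) ^ m * (1 - x k) ^ n)) = u m * u n" for m n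
    unfolding u_def sum_product by (intro sum.cong) auto
  have "(\<Sum>j=1..s. \<Sum>k=1..s. b j * b k * p (x j) (x k))
      = (u 1 * u 2 + u 2 * u 1) / 4 - (u 3 * u 0 + u 0 * u 3) / 12"
    unfolding uu[symmetric] p_def
    by (simp add: sum.distrib[symmetric] sum_subtractf[symmetric] sum_divide_distrib algebra_simps)
  then have poly: "(\<Sum>j=1..s. \<Sum>k=1..s. b j * b k * p (x j) (x k)) = 1 / 24"
    by (simp only: u) simp

  have "((\<lambda>t. (\<Sum>j=1..s. \<Sum>k=1..s. b j * b k * (max 0 (t - x j) * max 0 (t - x k))) -
          (\<Sum>k=1..s. b k * (max 0 (t - x k) * t\<^sup>2)) + t ^ 4 / 4) has_integral
        (\<Sum>j=1..s. \<Sum>k=1..s. b j * b k * (\<bar>x j - x k\<bar> ^ 3 / 12 + p (x j) (x k))) -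
        (\<Sum>k=1..s. b k * (1 / 4 - x k / 3 + x k ^ 4 / 12)) + 1 / 20) {0..1}"
  proof (intro has_integral_add has_integral_diff has_integral_sum has_integral_mult_right)
    show "((\<lambda>t. max 0 (t - x j) * max 0 (t - x k)) has_integral
        \<bar>x j - x k\<bar> ^ 3 / 12 + p (x j) (x k)) {0..1}" if "j \<in> {1..s}" "k \<in> {1..s}" for j k
      using has_integral_ramp_ramp[OF x[OF that(1)] x[OF that(2)]] by (simp add: p_def algebra_simps)
    show "((\<lambda>t::real. t ^ 4 / 4) has_integral 1 / 20) {0..1}"
    proof -
      have "((\<lambda>t::real. t ^ 4 / 4) has_integral 1 ^ 5 / 20 - 0 ^ 5 / 20) {0..1::real}"
        by (rule has_integral_vanishing_left[where f = "\<lambda>t. t ^ 4 / 4"])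
          (auto intro!: derivative_eq_intros)
      then show ?thesis by simp
    qed
  qed (use has_integral_ramp_square x in auto)
  moreover have "(\<Sum>j=1..s. \<Sum>k=1..s. b j * b k * (\<bar>x j - x k\<bar> ^ 3 / 12 + p (x j) (x k))) = 1 / 20"
  proof -
    have "(\<Sum>j=1..s. \<Sum>k=1..s. b j * b k * (\<bar>x j - x k\<bar> ^ 3 / 12 + p (x j) (x k)))
      = (\<Sum>j=1..s. \<Sum>k=1..s. b j * b k * \<bar>x j - x k\<bar> ^ 3) / 12
       + (\<Sum>j=1..s. \<Sum>k=1..s. b j * b k * p (x j) (x k))"
      by (simp add: sum.distrib distrib_left sum_divide_distrib)
    then show ?thesis by (simp only: poly cubic)
  qed
  moreover have "(\<Sum>k=1..s. b k * (1 / 4 - x k / 3 + x k ^ 4 / 12)) = 1 / 10"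
  proof -
    have "(\<Sum>k=1..s. b k * (1 / 4 - x k / 3 + x k ^ 4 / 12))
      = (\<Sum>k=1..s. b k) / 4 - (\<Sum>k=1..s. b k * x k) / 3 + (\<Sum>k=1..s. b k * x k ^ 4) / 12"
      by (simp add: sum.distrib sum_subtractf sum_divide_distrib algebra_simps)
    then show ?thesis by (simp only: m)
  qed
  moreover have "(F t)\<^sup>2 = (\<Sum>j=1..s. \<Sum>k=1..s. b j * b k * (max 0 (t - x j) * max 0 (t - x k))) -
          (\<Sum>k=1..s. b k * (max 0 (t - x k) * t\<^sup>2)) + t ^ 4 / 4" for t
  proof -
    let ?S = "\<Sum>k=1..s. b k * max 0 (t - x k)"
    have "(F t)\<^sup>2 = ?S * ?S - ?S * t\<^sup>2 + t ^ 4 / 4"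
      by (simp add: F_def field_simps power2_eq_square power4_eq_xxxx)
    moreover have "?S * ?S = (\<Sum>j=1..s. \<Sum>k=1..s. b j * b k * (max 0 (t - x j) * max 0 (t - x k)))"
      unfolding sum_product by (intro sum.cong) auto
    moreover have "?S * t\<^sup>2 = (\<Sum>k=1..s. b k * (max 0 (t - x k) * t\<^sup>2))"
      unfolding sum_distrib_right by (intro sum.cong) auto
    ultimately show ?thesis by simp
  qed
  ultimately have int: "((\<lambda>t. (F t)\<^sup>2) has_integral 0) (cbox 0 1)"
    by (simp only: cbox_interval) simp
  have cont: "continuous_on (cbox 0 1) (\<lambda>t. (F t)\<^sup>2)"
    unfolding F_def by (intro continuous_intros) auto
  have "F t = 0" if "t \<in> {0..1}" for t
    using has_integral_0_cbox_imp_0[OF cont _ int, of t] that by simp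
  then show False
    using ramp_combination_ne_parabola[of s x b] x by (auto simp: F_def)
qed

section \<open>Exponentials of forest matrices\<close>

text \<open>A rooted forest on the states \<open>0, ..., d - 1\<close> given by parents: every admitted state \<open>j\<close>
  is entered by a single arc, from \<open>par j\<close>, of weight \<open>t\<close>. Each column then has at most one
  nonzero entry, so that multiplication from the right is a substitution of columns.\<close>

definition arc_mat :: "nat \<Rightarrow> (nat \<Rightarrow> nat) \<Rightarrow> (nat \<Rightarrow> bool) \<Rightarrow> real \<Rightarrow> real mat" where
  "arc_mat d par E t = mat d d (\<lambda>(i, j). if i = par j \<and> E j then t else 0)"

lemma arc_mat_carrier [simp]: "arc_mat d par E t \<in> carrier_mat d d"
  by (simp add: arc_mat_def)

lemma dim_arc_mat [simp]: "dim_row (arc_mat d par E t) = d" "dim_col (arc_mat d par E t) = d"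
  by (simp_all add: arc_mat_def)

lemma smult_arc_mat: "r \<cdot>\<^sub>m arc_mat d par E t = arc_mat d par E (r * t)"
  by (auto simp: arc_mat_def)

lemma index_mult_mat_sum:
  assumes "X \<in> carrier_mat n m" "Y \<in> carrier_mat m q" "i < n" "j < q"
  shows "(X * Y) $$ (i, j) = (\<Sum>l<m. X $$ (i, l) * Y $$ (l, j))"
  using assms by (simp add: scalar_prod_def atLeast0LessThan)

lemma index_mult_arc_mat:
  assumes X: "X \<in> carrier_mat d d" and i: "i < d" and j: "j < d"
    and par: "E j \<Longrightarrow> par j < d"
  shows "(X * arc_mat d par E t) $$ (i, j) = (if E j then t * X $$ (i, par j) else 0)"
proof -
  have "(X * arc_mat d par E t) $$ (i, j) = (\<Sum>l<d. X $$ (i, l) * arc_mat d par E t $$ (l, j))"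
    using assms by (intro index_mult_mat_sum) auto
  also have "\<dots> = (\<Sum>l<d. if l = par j then (if E j then t * X $$ (i, par j) else 0) else 0)"
    using j by (intro sum.cong) (auto simp: arc_mat_def)
  also have "\<dots> = (if E j then t * X $$ (i, par j) else 0)"
    using par by (simp add: sum.delta)
  finally show ?thesis .
qed

text \<open>In a forest there is at most one path from \<open>i\<close> to \<open>j\<close>, and its length is the difference of
  the levels. Hence each entry of the exponential series has at most one nonzero term. The relation
  \<open>R\<close> says that such a path exists; its recursion peels off the last arc.\<close>

lemma mat_exp_arc_mat:
  assumes i: "i < d" and j: "j < d"
    and par: "\<And>k. k < d \<Longrightarrow> E k \<Longrightarrow> par k < d \<and> lev k = Suc (lev (par k))"
    and R: "\<And>i k. i < d \<Longrightarrow> k < d \<Longrightarrow> R i k \<longleftrightarrow> i = k \<or> E k \<and> R i (par k)"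
    and lev: "\<And>i k. R i k \<Longrightarrow> lev i \<le> lev k"
  shows "mat_exp (arc_mat d par E t) $$ (i, j)
    = (if R i j then t ^ (lev j - lev i) / fact (lev j - lev i) else 0)"
proof -
  have pow: "(arc_mat d par E t ^\<^sub>m k) $$ (i, j)
      = (if R i j \<and> lev j = lev i + k then t ^ k else 0)" if "j < d" for j k
    using that
  proof (induction k arbitrary: j)
    case 0
    have "R i j \<and> lev j = lev i \<longleftrightarrow> i = j"
      using R[OF i 0] par[OF 0] lev[of i "par j"] by auto
    then show ?case using i 0 by (auto simp: arc_mat_def)
  next
    case (Suc k)
    have "(arc_mat d par E t ^\<^sub>m Suc k) $$ (i, j)
        = (if E j then t * (arc_mat d par E t ^\<^sub>m k) $$ (i, par j) else 0)"
      using i Suc.prems par by (simp add: index_mult_arc_mat del: index_mult_mat(1))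
    also have "\<dots> = (if R i j \<and> lev j = lev i + Suc k then t ^ Suc k else 0)"
    proof -
      have "R i j \<and> lev j = lev i + Suc k \<longleftrightarrow> E j \<and> R i (par j) \<and> lev (par j) = lev i + k"
        using R[OF i Suc.prems] par[OF Suc.prems] lev[of i "par j"] by (cases "i = j"; cases "E j") auto
      then show ?thesis
        using Suc.IH[of "par j"] par[OF Suc.prems] by simp
    qed
    finally show ?case .
  qed
  have "mat_exp (arc_mat d par E t) $$ (i, j)
      = (\<Sum>k. if k = lev j - lev i then (if R i j then t ^ k / fact k else 0) else 0)"
    using i j lev by (auto simp: mat_exp_def pow intro!: suminf_cong)
  also have "\<dots> = (if R i j then t ^ (lev j - lev i) / fact (lev j - lev i) else 0)"
    by (rule sums_unique[OF sums_single[of "lev j - lev i" "\<lambda>k. if R i j then t ^ k / fact k else 0"], symmetric])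
  finally show ?thesis .
qed

lemma mat_exp_carrier: "X \<in> carrier_mat d d \<Longrightarrow> mat_exp X \<in> carrier_mat d d"
  by (simp add: mat_exp_def)

lemma mat_exp_zero: "mat_exp (0\<^sub>m d d :: real mat) = 1\<^sub>m d"
proof -
  have pow: "((0\<^sub>m d d :: real mat) ^\<^sub>m k) $$ (i, j) / fact k = (if k = 0 then 1\<^sub>m d $$ (i, j) else 0)"
    if "i < d" "j < d" for i j k
    using that by (cases k) auto
  have "mat_exp (0\<^sub>m d d :: real mat) $$ (i, j) = 1\<^sub>m d $$ (i, j)" if "i < d" "j < d" for i j
    using that by (simp add: mat_exp_def pow sums_unique[OF sums_single, symmetric])
  then show ?thesis
    by (intro eq_matI) (auto simp: mat_exp_def)
qed

section \<open>The test problem\<close>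

text \<open>The states form the prefix tree of the two words \<open>BAAAA\<close> and \<open>BAAAB\<close>: the path
  \<open>0, 1, 2, 3, 4, 5\<close> spells \<open>BAAAA\<close>, and \<open>6\<close> is a second child of \<open>4\<close> reached by
  \<open>B\<close>. An entry in row \<open>0\<close> of a product of exponentials of multiples of the two matrices
  is the coefficient of the word read on the path from the root, times a power of the step size.\<close>

definition trie_parent :: "nat \<Rightarrow> nat" where
  "trie_parent j = (if j = 6 then 4 else j - 1)"

definition trie_depth :: "nat \<Rightarrow> nat" where
  "trie_depth j = (if j = 6 then 5 else j)"

definition probeA :: "real mat" where
  "probeA = arc_mat 7 trie_parent (\<lambda>j. j \<in> {2..5}) 1"

definition probeB :: "real mat" where
  "probeB = arc_mat 7 trie_parent (\<lambda>j. j \<in> {1, 6}) 1"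

lemma probe_carrier [simp]: "probeA \<in> carrier_mat 7 7" "probeB \<in> carrier_mat 7 7"
  by (simp_all add: probeA_def probeB_def)

lemma probe_dim [simp]: "dim_row probeA = 7" "dim_col probeA = 7" "dim_row probeB = 7" "dim_col probeB = 7"
  by (simp_all add: probeA_def probeB_def)

lemma probe_sum: "probeA + probeB = arc_mat 7 trie_parent (\<lambda>j. j \<in> {1..6}) 1"
  by (rule eq_matI) (auto simp: probeA_def probeB_def arc_mat_def)

text \<open>The double commutator is \<open>BBA - 2 BAB + ABB\<close>, and none of the words \<open>BBA\<close>, \<open>BAB\<close>,
  \<open>ABB\<close> occurs as a contiguous subword of \<open>BAAAA\<close> or \<open>BAAAB\<close>. So the modified
  stages are ordinary ones on this problem.\<close>

lemma mat_comm_probe: "mat_comm probeB (mat_comm probeB probeA) = 0\<^sub>m 7 7"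
proof -
  have AB: "(X * probeA) $$ (i, j) = (if j \<in> {2..5} then X $$ (i, trie_parent j) else 0)"
       "(X * probeB) $$ (i, j) = (if j \<in> {1, 6} then X $$ (i, trie_parent j) else 0)"
    if "X \<in> carrier_mat 7 7" "i < 7" "j < 7" for X i j
    using that by (auto simp: probeA_def probeB_def index_mult_arc_mat trie_parent_def simp del: index_mult_mat(1))
  define C where "C = mat_comm probeB probeA"
  have C_carrier: "C \<in> carrier_mat 7 7"
    unfolding C_def mat_comm_def
    by (intro minus_carrier_mat mult_carrier_mat[of _ 7 7 _ 7] probe_carrier)
  have entry: "probeA $$ (i, j) = (if i = trie_parent j \<and> j \<in> {2..5} then 1 else 0)"
    "probeB $$ (i, j) = (if i = trie_parent j \<and> j \<in> {1, 6} then 1 else 0)"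
    if "i < 7" "j < 7" for i j
    using that by (simp_all add: probeA_def probeB_def arc_mat_def)
  have BA: "(probeB * probeA) $$ (i, j) = (if i = 0 \<and> j = 2 then 1 else 0)"
    and AB': "(probeA * probeB) $$ (i, j) = (if i = 3 \<and> j = 6 then 1 else 0)"
    if "i < 7" "j < 7" for i j
    using that
    by (auto simp del: index_mult_mat simp add: AB entry trie_parent_def)
  have C: "C $$ (i, j) = (if i = 0 \<and> j = 2 then 1 else if i = 3 \<and> j = 6 then - 1 else 0)"
    if "i < 7" "j < 7" for i j
    using that by (auto simp del: index_mult_mat(1) simp add: C_def mat_comm_def BA AB')
  have "(C * probeB) $$ (i, j) = 0" "(probeB * C) $$ (i, j) = 0" if "i < 7" "j < 7" for i j
  proof -
    show "(C * probeB) $$ (i, j) = 0"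
      using that by (subst AB) (auto simp: C C_carrier trie_parent_def)
    show "(probeB * C) $$ (i, j) = 0"
      using that by (subst index_mult_mat_sum[of _ 7 7 _ 7])
        (auto simp: C C_carrier probeB_def arc_mat_def trie_parent_def intro!: sum.neutral)
  qed
  then show ?thesis
    unfolding C_def[symmetric] unfolding mat_comm_def
    using C_carrier by (intro eq_matI) (auto simp del: index_mult_mat(1))
qed

lemma mat_exp_probeA:
  assumes "i < 7" "j < 7"
  shows "mat_exp (t \<cdot>\<^sub>m probeA) $$ (i, j)
    = (if i = j then 1 else if 1 \<le> i \<and> i \<le> j \<and> j \<le> 5 then t ^ (j - i) / fact (j - i) else 0)"
proof -
  have "mat_exp (t \<cdot>\<^sub>m probeA) $$ (i, j) = (if i = j \<or> 1 \<le> i \<and> i \<le> j \<and> j \<le> 5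
      then (t * 1) ^ (trie_depth j - trie_depth i) / fact (trie_depth j - trie_depth i) else 0)"
    unfolding probeA_def smult_arc_mat using assms
    by (intro mat_exp_arc_mat) (auto simp: trie_parent_def trie_depth_def)
  then show ?thesis using assms by (auto simp: trie_depth_def)
qed

lemma mat_exp_probeB:
  assumes "i < 7" "j < 7"
  shows "mat_exp (t \<cdot>\<^sub>m probeB) $$ (i, j)
    = (if i = j then 1 else if (i, j) \<in> {(0, 1), (4, 6)} then t else 0)"
proof -
  have "mat_exp (t \<cdot>\<^sub>m probeB) $$ (i, j) = (if i = j \<or> (i, j) \<in> {(0, 1), (4, 6)}
      then (t * 1) ^ (trie_depth j - trie_depth i) / fact (trie_depth j - trie_depth i) else 0)"
    unfolding probeB_def smult_arc_mat using assms
    by (intro mat_exp_arc_mat) (auto simp: trie_parent_def trie_depth_def)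
  then show ?thesis using assms by (auto simp: trie_depth_def)
qed

lemma mat_exp_probe_sum:
  assumes "i < 7" "j < 7"
  shows "mat_exp (t \<cdot>\<^sub>m (probeA + probeB)) $$ (i, j)
    = (if i = j \<or> i \<le> j \<and> j \<le> 5 \<or> i \<le> 4 \<and> j = 6
       then t ^ (trie_depth j - trie_depth i) / fact (trie_depth j - trie_depth i) else 0)"
proof -
  have "mat_exp (t \<cdot>\<^sub>m (probeA + probeB)) $$ (i, j)
    = (if i = j \<or> i \<le> j \<and> j \<le> 5 \<or> i \<le> 4 \<and> j = 6
      then (t * 1) ^ (trie_depth j - trie_depth i) / fact (trie_depth j - trie_depth i) else 0)"
    unfolding probe_sum smult_arc_mat using assms
    by (intro mat_exp_arc_mat) (auto simp: trie_parent_def trie_depth_def)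
  then show ?thesis by simp
qed


section \<open>The splitting on the test problem\<close>

text \<open>The form that both schemes take when the double commutator vanishes. Exponentials of multiples of
  \<open>A\<close> are called drifts below, those of \<open>B\<close> kicks. The kick is applied to the
  drifted state, so that each factor acts on rows by itself.\<close>

primrec plain_splitting ::
  "(nat \<Rightarrow> real) \<Rightarrow> (nat \<Rightarrow> real) \<Rightarrow> nat \<Rightarrow> real mat \<Rightarrow> real mat \<Rightarrow> real \<Rightarrow> real mat" where
  "plain_splitting a b 0 A B \<tau> = 1\<^sub>m (dim_row A)"
| "plain_splitting a b (Suc n) A B \<tau> =
     mat_exp (b (Suc n) * \<tau> \<cdot>\<^sub>m B) * (mat_exp (a (Suc n) * \<tau> \<cdot>\<^sub>m A) * plain_splitting a b n A B \<tau>)"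

lemma plain_splitting_carrier:
  "A \<in> carrier_mat d d \<Longrightarrow> B \<in> carrier_mat d d \<Longrightarrow> plain_splitting a b n A B \<tau> \<in> carrier_mat d d"
  by (induction n) (auto intro!: mult_carrier_mat mat_exp_carrier)

lemma splitting_eq_plain_splitting:
  assumes A: "A \<in> carrier_mat d d" and B: "B \<in> carrier_mat d d"
    and comm: "mat_comm B (mat_comm B A) = 0\<^sub>m d d"
  shows "splitting1 a b c n A B \<tau> = plain_splitting a b n A B \<tau>"
    and "splitting2 a b c n A B \<tau> = plain_splitting a b n A B \<tau>"
proof -
  have zero: "r \<cdot>\<^sub>m (0\<^sub>m d d :: real mat) = 0\<^sub>m d d" for r
    by (intro eq_matI) auto
  have carrier: "mat_exp (r \<cdot>\<^sub>m A) \<in> carrier_mat d d" "mat_exp (r \<cdot>\<^sub>m B) \<in> carrier_mat d d" for r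
    using A B by (auto intro!: mat_exp_carrier)
  note S = plain_splitting_carrier[OF A B]
  have assoc: "mat_exp (r \<cdot>\<^sub>m B) * mat_exp (q \<cdot>\<^sub>m A) * plain_splitting a b n A B \<tau>
      = mat_exp (r \<cdot>\<^sub>m B) * (mat_exp (q \<cdot>\<^sub>m A) * plain_splitting a b n A B \<tau>)" for r q n
    by (rule assoc_mult_mat[OF carrier(2,1) S])
  have one: "1\<^sub>m d * mat_exp (r \<cdot>\<^sub>m B) = mat_exp (r \<cdot>\<^sub>m B)" for r
    by (rule left_mult_one_mat[OF carrier(2)])
  have add: "r \<cdot>\<^sub>m B + 0\<^sub>m d d = r \<cdot>\<^sub>m B" for r
    using B by simp
  show "splitting1 a b c n A B \<tau> = plain_splitting a b n A B \<tau>"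
    by (induction n) (simp_all add: comm zero mat_exp_zero one assoc)
  show "splitting2 a b c n A B \<tau> = plain_splitting a b n A B \<tau>"
    by (induction n) (simp_all add: comm zero add assoc)
qed

definition exp_term :: "real \<Rightarrow> nat \<Rightarrow> real" where
  "exp_term t k = t ^ k / fact k"

text \<open>The binomial theorem for divided powers, which is how successive drifts combine.\<close>

lemma exp_term_add:
  assumes "i \<le> j"
  shows "(\<Sum>l=i..j. exp_term u (l - i) * exp_term v (j - l)) = exp_term (u + v) (j - i)"
proof -
  have "exp_term (u + v) (j - i) = (\<Sum>m\<le>j - i. exp_term u m * exp_term v (j - i - m))"
    using exp_series_add_commuting[of u v "j - i"]
    by (simp add: exp_term_def divide_inverse mult.commute)
  also have "\<dots> = (\<Sum>l=i..j. exp_term u (l - i) * exp_term v (j - l))"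
    using assms by (intro sum.reindex_bij_witness[of _ "\<lambda>l. l - i" "\<lambda>m. m + i"])
      (auto simp: add.commute)
  finally show ?thesis by simp
qed

lemma exp_term_0: "exp_term 0 k = (if k = 0 then 1 else 0)"
  by (simp add: exp_term_def)

lemma index_mat_exp_probeA_mult:
  assumes M: "M \<in> carrier_mat 7 7" and ij: "i < 7" "j < 7"
  shows "(mat_exp (t \<cdot>\<^sub>m probeA) * M) $$ (i, j)
    = (if i \<in> {1..5} then \<Sum>l=i..5. exp_term t (l - i) * M $$ (l, j) else M $$ (i, j))"
proof -
  have "(mat_exp (t \<cdot>\<^sub>m probeA) * M) $$ (i, j) = (\<Sum>l<7. mat_exp (t \<cdot>\<^sub>m probeA) $$ (i, l) * M $$ (l, j))"
    using assms by (intro index_mult_mat_sum) (auto intro: mat_exp_carrier)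
  also have "\<dots> = (\<Sum>l\<in>(if i \<in> {1..5} then {i..5} else {i}). exp_term t (l - i) * M $$ (l, j))"
    by (rule sum.mono_neutral_cong_right)
      (use ij in \<open>auto simp: mat_exp_probeA exp_term_def split: if_splits\<close>)
  finally show ?thesis by (auto simp: exp_term_def)
qed

lemma index_mat_exp_probeB_mult:
  assumes M: "M \<in> carrier_mat 7 7" and ij: "i < 7" "j < 7"
  shows "(mat_exp (t \<cdot>\<^sub>m probeB) * M) $$ (i, j) = M $$ (i, j) +
    (if i = 0 then t * M $$ (1, j) else if i = 4 then t * M $$ (6, j) else 0)"
proof -
  have "(mat_exp (t \<cdot>\<^sub>m probeB) * M) $$ (i, j) = (\<Sum>l<7. mat_exp (t \<cdot>\<^sub>m probeB) $$ (i, l) * M $$ (l, j))"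
    using assms by (intro index_mult_mat_sum) (auto intro: mat_exp_carrier)
  also have "\<dots> = (\<Sum>l<7. (if l = i then M $$ (l, j) else 0) + (if l = 1 \<and> i = 0 then t * M $$ (l, j) else 0)
      + (if l = 6 \<and> i = 4 then t * M $$ (l, j) else 0))"
    by (rule sum.cong) (use ij in \<open>auto simp: mat_exp_probeB\<close>)
  also have "\<dots> = M $$ (i, j) + (if i = 0 then t * M $$ (1, j) else 0) + (if i = 4 then t * M $$ (6, j) else 0)"
    using ij by (simp add: sum.distrib)
  finally show ?thesis by auto
qed

text \<open>The accumulated drift after stage \<open>k\<close>, the point at which the kick of weight \<open>b k\<close>
  takes place.\<close>

definition node :: "(nat \<Rightarrow> real) \<Rightarrow> nat \<Rightarrow> real" where
  "node a k = (\<Sum>j=1..k. a j)"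

lemma node_Suc: "node a (Suc n) = node a n + a (Suc n)"
  by (simp add: node_def)

abbreviation probe_splitting :: "(nat \<Rightarrow> real) \<Rightarrow> (nat \<Rightarrow> real) \<Rightarrow> nat \<Rightarrow> real \<Rightarrow> real mat" where
  "probe_splitting a b n \<tau> \<equiv> plain_splitting a b n probeA probeB \<tau>"

text \<open>One stage acts on rows: the drift \<open>T\<close> mixes the rows \<open>1, ..., 5\<close>, and the kick then adds
  row \<open>1\<close> to row \<open>0\<close> and row \<open>6\<close> to row \<open>4\<close>, along the two \<open>B\<close>-arcs.\<close>

lemma probe_splitting_step:
  fixes a b :: "nat \<Rightarrow> real" and \<tau> :: real and n i j :: nat
  assumes ij: "i < 7" "j < 7"
  defines "T \<equiv> \<lambda>i. if i \<in> {1..5}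
    then \<Sum>l=i..5. exp_term (a (Suc n) * \<tau>) (l - i) * probe_splitting a b n \<tau> $$ (l, j)
    else probe_splitting a b n \<tau> $$ (i, j)"
  shows "probe_splitting a b (Suc n) \<tau> $$ (i, j) = T i +
    (if i = 0 then b (Suc n) * \<tau> * T 1 else if i = 4 then b (Suc n) * \<tau> * T 6 else 0)"
proof -
  have S: "probe_splitting a b n \<tau> \<in> carrier_mat 7 7"
    by (intro plain_splitting_carrier probe_carrier)
  then have P: "mat_exp (a (Suc n) * \<tau> \<cdot>\<^sub>m probeA) * probe_splitting a b n \<tau> \<in> carrier_mat 7 7"
    by (intro mult_carrier_mat) (auto intro: mat_exp_carrier)
  have T: "(mat_exp (a (Suc n) * \<tau> \<cdot>\<^sub>m probeA) * probe_splitting a b n \<tau>) $$ (k, j) = T k"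
    if "k < 7" for k
    unfolding T_def by (rule index_mat_exp_probeA_mult[OF S that ij(2)])
  show ?thesis
    unfolding plain_splitting.simps index_mat_exp_probeB_mult[OF P ij] using ij by (auto simp: T)
qed

lemma probe_splitting_row6:
  assumes "j < 7"
  shows "probe_splitting a b n \<tau> $$ (6, j) = (if j = 6 then 1 else 0)"
  by (induction n) (use assms in \<open>auto simp: probe_splitting_step simp del: plain_splitting.simps(2)\<close>)

lemma probe_splitting_drift:
  assumes "i \<in> {1..5}" "j \<in> {1..5}"
  shows "probe_splitting a b n \<tau> $$ (i, j) = (if i \<le> j then exp_term (node a n * \<tau>) (j - i) else 0)"
  using assms(1)
proof (induction n arbitrary: i)
  case 0
  then show ?case using assms by (auto simp: node_def exp_term_0)
next
  case (Suc n)
  have "probe_splitting a b (Suc n) \<tau> $$ (i, j)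
      = (\<Sum>l=i..5. exp_term (a (Suc n) * \<tau>) (l - i) * probe_splitting a b n \<tau> $$ (l, j))"
    using assms Suc.prems probe_splitting_row6[of j]
    by (subst probe_splitting_step) auto
  also have "\<dots> = (\<Sum>l=i..5. exp_term (a (Suc n) * \<tau>) (l - i) *
      (if l \<le> j then exp_term (node a n * \<tau>) (j - l) else 0))"
    using Suc by (intro sum.cong) auto
  also have "\<dots> = (\<Sum>l=i..j. exp_term (a (Suc n) * \<tau>) (l - i) * exp_term (node a n * \<tau>) (j - l))"
    by (rule sum.mono_neutral_cong_right) (use assms in auto)
  also have "\<dots> = (if i \<le> j then exp_term (node a (Suc n) * \<tau>) (j - i) else 0)"
    using exp_term_add[of i j "a (Suc n) * \<tau>" "node a n * \<tau>"]
    by (simp add: node_Suc distrib_right add.commute)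
  finally show ?case .
qed

lemma probe_splitting_56: "probe_splitting a b n \<tau> $$ (5, 6) = 0"
  by (induction n) (auto simp: probe_splitting_step exp_term_def simp del: plain_splitting.simps(2))

text \<open>The words \<open>A ... AB\<close>: a kick in stage \<open>k\<close> and after it a drift over the remaining
  distance \<open>node a n - node a k\<close>. The second equation is the state between the drift and the
  kick of the next stage, from which that kick completes the word \<open>BAAAB\<close>.\<close>

lemma probe_splitting_kick_drift:
  assumes "i \<in> {1..4}"
  shows "probe_splitting a b n \<tau> $$ (i, 6)
    = (\<Sum>k=1..n. b k * \<tau> * exp_term ((node a n - node a k) * \<tau>) (4 - i))"
    and "(\<Sum>l=i..5. exp_term (a (Suc n) * \<tau>) (l - i) * probe_splitting a b n \<tau> $$ (l, 6))
    = (\<Sum>k=1..n. b k * \<tau> * exp_term ((node a (Suc n) - node a k) * \<tau>) (4 - i))"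
proof -
  have drift: "(\<Sum>l=i..5. exp_term (a (Suc n) * \<tau>) (l - i) * probe_splitting a b n \<tau> $$ (l, 6))
    = (\<Sum>k=1..n. b k * \<tau> * exp_term ((node a (Suc n) - node a k) * \<tau>) (4 - i))"
    if i: "i \<in> {1..4}" and IH: "\<And>l. l \<in> {1..4} \<Longrightarrow> probe_splitting a b n \<tau> $$ (l, 6)
      = (\<Sum>k=1..n. b k * \<tau> * exp_term ((node a n - node a k) * \<tau>) (4 - l))" for i n
  proof -
    have "(\<Sum>l=i..5. exp_term (a (Suc n) * \<tau>) (l - i) * probe_splitting a b n \<tau> $$ (l, 6))
      = (\<Sum>l=i..4. exp_term (a (Suc n) * \<tau>) (l - i) * probe_splitting a b n \<tau> $$ (l, 6))"
    proof -
      have "{i..5} = insert 5 {i..4}" using i by auto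
      then show ?thesis by (simp add: probe_splitting_56)
    qed
    also have "\<dots> = (\<Sum>l=i..4. \<Sum>k=1..n. b k * \<tau> * (exp_term (a (Suc n) * \<tau>) (l - i) *
        exp_term ((node a n - node a k) * \<tau>) (4 - l)))"
      using i by (intro sum.cong) (auto simp: IH sum_distrib_left algebra_simps)
    also have "\<dots> = (\<Sum>k=1..n. b k * \<tau> * (\<Sum>l=i..4. exp_term (a (Suc n) * \<tau>) (l - i) *
        exp_term ((node a n - node a k) * \<tau>) (4 - l)))"
      unfolding sum_distrib_left by (rule sum.swap)
    also have "\<dots> = (\<Sum>k=1..n. b k * \<tau> * exp_term ((node a (Suc n) - node a k) * \<tau>) (4 - i))"
      using i by (intro sum.cong) (auto simp: exp_term_add node_Suc algebra_simps)
    finally show ?thesis .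
  qed
  have col: "probe_splitting a b n \<tau> $$ (i, 6)
    = (\<Sum>k=1..n. b k * \<tau> * exp_term ((node a n - node a k) * \<tau>) (4 - i))" if "i \<in> {1..4}" for i
    using that
  proof (induction n arbitrary: i)
    case 0
    then show ?case by auto
  next
    case (Suc n)
    have "probe_splitting a b (Suc n) \<tau> $$ (i, 6)
      = (\<Sum>l=i..5. exp_term (a (Suc n) * \<tau>) (l - i) * probe_splitting a b n \<tau> $$ (l, 6))
        + (if i = 4 then b (Suc n) * \<tau> else 0)"
      using Suc.prems by (subst probe_splitting_step) (auto simp: probe_splitting_row6)
    then show ?case
      using drift[OF Suc.prems Suc.IH] Suc.prems by (auto simp: exp_term_0)
  qed
  show "probe_splitting a b n \<tau> $$ (i, 6)
    = (\<Sum>k=1..n. b k * \<tau> * exp_term ((node a n - node a k) * \<tau>) (4 - i))"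
    by (rule col[OF assms])
  show "(\<Sum>l=i..5. exp_term (a (Suc n) * \<tau>) (l - i) * probe_splitting a b n \<tau> $$ (l, 6))
    = (\<Sum>k=1..n. b k * \<tau> * exp_term ((node a (Suc n) - node a k) * \<tau>) (4 - i))"
    by (rule drift[OF assms col])
qed

text \<open>The words \<open>BA ... A\<close>: a single kick after the drift accumulated so far.\<close>

lemma probe_splitting_moment:
  assumes j: "j \<in> {1..5}"
  shows "probe_splitting a b n \<tau> $$ (0, j)
    = (\<Sum>k=1..n. b k * \<tau> * exp_term (node a k * \<tau>) (j - 1))"
proof (induction n)
  case 0
  then show ?case using j by auto
next
  case (Suc n)
  have "probe_splitting a b (Suc n) \<tau> $$ (1, j)
      = (\<Sum>l=1..5. exp_term (a (Suc n) * \<tau>) (l - 1) * probe_splitting a b n \<tau> $$ (l, j))"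
    using j by (subst probe_splitting_step) auto
  moreover have "probe_splitting a b (Suc n) \<tau> $$ (0, j) = probe_splitting a b n \<tau> $$ (0, j) + b (Suc n) * \<tau> *
      (\<Sum>l=1..5. exp_term (a (Suc n) * \<tau>) (l - 1) * probe_splitting a b n \<tau> $$ (l, j))"
    using j by (subst probe_splitting_step) auto
  ultimately show ?case
    using probe_splitting_drift[of 1 j a b "Suc n" \<tau>] j Suc.IH by simp
qed

text \<open>The word \<open>BAAAB\<close>: an earlier kick in stage \<open>j\<close>, three drifts, and a later kick in stage
  \<open>k\<close>. Two kicks in the same stage contribute nothing, as no drift separates them; this is why
  the inner sum is over \<open>j < k\<close> only.\<close>

lemma probe_splitting_double_kick:
  "probe_splitting a b n \<tau> $$ (0, 6)
    = (\<Sum>k=1..n. b k * \<tau> * (\<Sum>j=1..<k. b j * \<tau> * exp_term ((node a k - node a j) * \<tau>) 3))"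
proof (induction n)
  case 0
  then show ?case by simp
next
  case (Suc n)
  have "probe_splitting a b (Suc n) \<tau> $$ (0, 6) = probe_splitting a b n \<tau> $$ (0, 6) + b (Suc n) * \<tau> *
      (\<Sum>l=1..5. exp_term (a (Suc n) * \<tau>) (l - 1) * probe_splitting a b n \<tau> $$ (l, 6))"
    by (subst probe_splitting_step) auto
  then show ?case
    using probe_splitting_kick_drift(2)[of 1 a n \<tau> b] Suc.IH
    by (simp add: atLeastLessThanSuc_atLeastAtMost)
qed

section \<open>Order conditions\<close>

lemma monomial_bigo_imp_zero:
  fixes q :: real
  assumes "(\<lambda>\<tau>. norm (q * \<tau> ^ m)) \<in> O[at 0](\<lambda>\<tau>. \<tau> ^ (p + 1))" and "m \<le> p"
  shows "q = 0"
proof -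
  obtain K where K: "eventually (\<lambda>\<tau>. norm (norm (q * \<tau> ^ m)) \<le> K * norm (\<tau> ^ (p + 1))) (at 0)"
    using assms(1) by (elim landau_o.bigE)
  have "eventually (\<lambda>\<tau>. \<bar>q\<bar> \<le> K * \<bar>\<tau>\<bar> ^ (p + 1 - m)) (at (0::real))"
    using K eventually_neq_at_within[of 0 0 UNIV]
  proof eventually_elim
    case (elim \<tau>)
    have "\<tau> ^ (p + 1) = \<tau> ^ (p + 1 - m) * \<tau> ^ m"
      using assms(2) by (simp add: power_add[symmetric])
    then have "\<bar>q\<bar> * \<bar>\<tau> ^ m\<bar> \<le> (K * \<bar>\<tau>\<bar> ^ (p + 1 - m)) * \<bar>\<tau> ^ m\<bar>"
      using elim by (simp add: abs_mult power_abs mult.assoc)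
    then show ?case using elim by (simp add: mult_le_cancel_right)
  qed
  moreover have "((\<lambda>\<tau>. K * \<bar>\<tau>\<bar> ^ (p + 1 - m)) \<longlongrightarrow> K * \<bar>0\<bar> ^ (p + 1 - m)) (at (0::real))"
    by (intro tendsto_intros)
  ultimately have "\<bar>q\<bar> \<le> K * \<bar>0\<bar> ^ (p + 1 - m)"
    by (intro tendsto_lowerbound[OF _ _ trivial_limit_at]) auto
  then show ?thesis using assms(2) by (simp add: Suc_diff_le)
qed

text \<open>Both sides of the order estimate are, entry by entry, monomials in \<open>\<tau>\<close> of degree at most
  \<open>5\<close>, so their coefficients agree. The entries used belong to the words \<open>A\<close>,
  \<open>BA ... A\<close> and \<open>BAAAB\<close>. The abstract class \<open>P\<close> and scheme \<open>S\<close> let the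
  three cases of the theorem share this argument.\<close>

lemma order_conditions:
  assumes order: "order_on P S p" and p: "p \<ge> 5"
    and P: "P probeA probeB" and S: "S probeA probeB = probe_splitting a b s"
  shows "node a s = 1"
    and "\<And>m. m \<le> 4 \<Longrightarrow> (\<Sum>k=1..s. b k * node a k ^ m) = 1 / (real m + 1)"
    and "(\<Sum>k=1..s. \<Sum>j=1..<k. b k * b j * (node a k - node a j) ^ 3) = 1 / 20"
proof -
  have defect: "(\<lambda>\<tau>. norm (probe_splitting a b s \<tau> $$ (i, j)
      - mat_exp (\<tau> \<cdot>\<^sub>m (probeA + probeB)) $$ (i, j))) \<in> O[at 0](\<lambda>\<tau>. \<tau> ^ (p + 1))"
    if "i < 7" "j < 7" for i j
  proof -
    have exact: "mat_exp (\<tau> \<cdot>\<^sub>m (probeA + probeB)) \<in> carrier_mat 7 7" for \<tau>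
      by (intro mat_exp_carrier) simp
    have "(probe_splitting a b s \<tau> - mat_exp (\<tau> \<cdot>\<^sub>m (probeA + probeB))) $$ (i, j)
        = probe_splitting a b s \<tau> $$ (i, j) - mat_exp (\<tau> \<cdot>\<^sub>m (probeA + probeB)) $$ (i, j)" for \<tau>
      by (rule index_minus_mat) (use that carrier_matD[OF exact] in auto)
    moreover have "(\<lambda>\<tau>. norm ((S probeA probeB \<tau> - mat_exp (of_real \<tau> \<cdot>\<^sub>m (probeA + probeB))) $$ (i, j)))
        \<in> O[at 0](\<lambda>\<tau>. \<tau> ^ (p + 1))"
      using order[unfolded order_on_def, rule_format, of 7 probeA probeB i j] P that by simp
    ultimately show ?thesis by (simp add: S)
  qed
  have coeff: "u = v"
    if ij: "i < 7" "j < 7" "m \<le> 5"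
      and u: "\<And>\<tau>. probe_splitting a b s \<tau> $$ (i, j) = u * \<tau> ^ m"
      and v: "\<And>\<tau>. mat_exp (\<tau> \<cdot>\<^sub>m (probeA + probeB)) $$ (i, j) = v * \<tau> ^ m" for i j m u v
  proof -
    have "u - v = 0"
    proof (rule monomial_bigo_imp_zero)
      show "(\<lambda>\<tau>. norm ((u - v) * \<tau> ^ m)) \<in> O[at 0](\<lambda>\<tau>. \<tau> ^ (p + 1))"
        using defect[OF ij(1,2)] by (simp add: u v left_diff_distrib)
    qed (use ij p in simp)
    then show ?thesis by simp
  qed

  show "node a s = 1"
    by (rule coeff[of 1 2 1])
      (simp_all add: probe_splitting_drift exp_term_def mat_exp_probe_sum trie_depth_def)

  show "(\<Sum>k=1..s. b k * node a k ^ m) = 1 / (real m + 1)" if m: "m \<le> 4" for m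
  proof -
    have "(\<Sum>k=1..s. b k * node a k ^ m) / fact m = 1 / fact (Suc m)"
    proof (rule coeff[of 0 "Suc m" "Suc m"])
      show "probe_splitting a b s \<tau> $$ (0, Suc m) = (\<Sum>k=1..s. b k * node a k ^ m) / fact m * \<tau> ^ Suc m" for \<tau>
        using m by (subst probe_splitting_moment)
          (auto simp: exp_term_def sum_distrib_right sum_divide_distrib power_mult_distrib intro!: sum.cong)
      show "mat_exp (\<tau> \<cdot>\<^sub>m (probeA + probeB)) $$ (0, Suc m) = 1 / fact (Suc m) * \<tau> ^ Suc m" for \<tau>
        using m by (subst mat_exp_probe_sum) (auto simp: trie_depth_def)
    qed (use m in auto)
    then show ?thesis
      by (simp add: divide_simps add.commute split: if_splits)
  qed

  have "(\<Sum>k=1..s. \<Sum>j=1..<k. b k * b j * (node a k - node a j) ^ 3) / 6 = 1 / 120"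
  proof (rule coeff[of 0 6 5])
    show "probe_splitting a b s \<tau> $$ (0, 6)
        = (\<Sum>k=1..s. \<Sum>j=1..<k. b k * b j * (node a k - node a j) ^ 3) / 6 * \<tau> ^ 5" for \<tau>
      unfolding probe_splitting_double_kick sum_divide_distrib sum_distrib_right sum_distrib_left
      by (intro sum.cong) (auto simp: exp_term_def power_mult_distrib fact_numeral numeral_eq_Suc)
    show "mat_exp (\<tau> \<cdot>\<^sub>m (probeA + probeB)) $$ (0, 6) = 1 / 120 * \<tau> ^ 5" for \<tau>
      by (subst mat_exp_probe_sum) (auto simp: trie_depth_def fact_numeral)
  qed auto
  then show "(\<Sum>k=1..s. \<Sum>j=1..<k. b k * b j * (node a k - node a j) ^ 3) = 1 / 20"
    by linarith
qed

text \<open>Nonnegative \<open>a\<close> put the nodes into \<open>{0..1}\<close> in increasing order. The ordering is what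
  turns the signed cubes of the last order condition into the kernel \<open>\<bar>x - y\<bar> ^ 3\<close>.\<close>

lemma order_five_imp_negative_drift:
  assumes "order_on P S p" "p \<ge> 5" "P probeA probeB" "S probeA probeB = probe_splitting a b s"
  shows "\<exists>j\<in>{1..s}. a j < 0"
proof (rule ccontr)
  assume "\<not> ?thesis"
  then have nonneg: "0 \<le> a j" if "j \<in> {1..s}" for j
    using that by (meson not_less)
  note conditions = order_conditions[OF assms]
  have mono: "node a j \<le> node a k" if "j \<le> k" "k \<le> s" for j k
    unfolding node_def by (rule sum_mono2) (use that nonneg in auto)
  have unit: "node a k \<in> {0..1}" if "k \<in> {1..s}" for k
    using mono[of 0 k] mono[of k s] that conditions(1) by (simp add: node_def)
  have "(\<Sum>j=1..s. \<Sum>k=1..s. b j * b k * \<bar>node a j - node a k\<bar> ^ 3)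
      = 2 * (\<Sum>k=1..s. \<Sum>j=1..<k. b j * b k * \<bar>node a j - node a k\<bar> ^ 3)"
    by (rule sum_symmetric_off_diagonal) (simp_all add: abs_minus_commute)
  also have "(\<Sum>k=1..s. \<Sum>j=1..<k. b j * b k * \<bar>node a j - node a k\<bar> ^ 3)
      = (\<Sum>k=1..s. \<Sum>j=1..<k. b k * b j * (node a k - node a j) ^ 3)"
  proof (intro sum.cong refl)
    fix j k assume "k \<in> {1..s}" "j \<in> {1..<k}"
    then have "\<bar>node a j - node a k\<bar> = node a k - node a j"
      using mono[of j k] by simp
    then show "b j * b k * \<bar>node a j - node a k\<bar> ^ 3 = b k * b j * (node a k - node a j) ^ 3"
      by (simp add: mult.commute)
  qed
  finally have "(\<Sum>j=1..s. \<Sum>k=1..s. b j * b k * \<bar>node a j - node a k\<bar> ^ 3) = 1 / 10"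
    unfolding conditions(3) by simp
  moreover have "(\<Sum>j=1..s. \<Sum>k=1..s. b j * b k * \<bar>node a j - node a k\<bar> ^ 3) \<noteq> 1 / 10"
    by (rule exact_quadrature_cubic_energy_ne) (use unit conditions(2) in auto)
  ultimately show False by contradiction
qed

theorem theorem2:
  fixes s :: nat and a b c :: "nat \<Rightarrow> real"
  assumes "s \<ge> 1"
  shows
    "((\<exists>p\<ge>5. order_on any_problem (splitting1 a b c s :: real mat \<Rightarrow> _) p \<and>
             order_on any_problem (splitting1 a b c s :: complex mat \<Rightarrow> _) p) \<or>
      (\<exists>p\<ge>5. order_on any_problem (splitting2 a b c s :: real mat \<Rightarrow> _) p \<and>
             order_on any_problem (splitting2 a b c s :: complex mat \<Rightarrow> _) p)
        \<longrightarrow> (\<exists>j\<in>{1..s}. a j < 0)) \<and>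
     ((\<exists>p\<ge>5. order_on triple_comm_zero (splitting2 a b c s :: real mat \<Rightarrow> _) p \<and>
             order_on triple_comm_zero (splitting2 a b c s :: complex mat \<Rightarrow> _) p)
        \<longrightarrow> (\<exists>j\<in>{1..s}. a j < 0))"
proof -
  have schemes: "splitting1 a b c s probeA probeB = probe_splitting a b s"
    "splitting2 a b c s probeA probeB = probe_splitting a b s"
    using splitting_eq_plain_splitting[OF probe_carrier mat_comm_probe] by (auto intro: ext)
  have any: "any_problem probeA probeB"
    by (simp add: any_problem_def)
  have triple: "triple_comm_zero probeA probeB"
    unfolding triple_comm_zero_def mat_comm_probe by (simp add: mat_comm_def)
  note negative = order_five_imp_negative_drift[where a = a and b = b and s = s]
  show ?thesis
    using negative[where P = any_problem and S = "splitting1 a b c s", OF _ _ any schemes(1)]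
      negative[where P = any_problem and S = "splitting2 a b c s", OF _ _ any schemes(2)]
      negative[where P = triple_comm_zero and S = "splitting2 a b c s", OF _ _ triple schemes(2)]
    by blast
qed

end
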